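(* Let $Y$ and $Z$ be two topological spaces that are Hausdorff, locally compact and $\sigma$-compact, first-countable, and have cardinality $2^{\aleph_0}$. Then, there exist partitions $\{A_1,A_2,A_3\}$ of $Y$ and $\{B_1,B_2,B_3\}$ of $Z$ such that for every closed subset $F\subseteq Y\times Z$, at least one of the following holds: - $F$ can be covered by countably many lines, i.e., subsets of the form $\{y\}\times Z$ or $Y\times\{z\}$ with $y\in Y$ and $z\in Z$; - $F$ meets each of the nine subsets $A_i\times B_j$ for $i,j\in\{1,2,3\}$.
   Context: $Y\times Z$ carries the product topology. "$\sigma$-compact" means a countable union of compact subsets. *)

theory Defs
  imports "HOL-Analysis.Analysis" "HOL-Library.Disjoint_Sets" "HOL-Library.Equipollence"
begin

definition sigma_compact_space :: "'a topology \<Rightarrow> bool" where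
  "sigma_compact_space X \<longleftrightarrow>
     (\<exists>\<K>. countable \<K> \<and> (\<forall>K\<in>\<K>. compactin X K) \<and> \<Union>\<K> = topspace X)"

definition lines :: "'a topology \<Rightarrow> 'b topology \<Rightarrow> ('a \<times> 'b) set set" where
  "lines Y Z = {{y} \<times> topspace Z |y. y \<in> topspace Y} \<union> {topspace Y \<times> {z} |z. z \<in> topspace Z}"

text \<open>The injectivity condition ensures that the three parts are distinct, so that there
  really are three of them; \<^const>\<open>partition_on\<close> makes them disjoint and nonempty.\<close>

definition partition_into_three :: "'a set \<Rightarrow> (nat \<Rightarrow> 'a set) \<Rightarrow> bool" where
  "partition_into_three S A \<longleftrightarrow> inj_on A {1, 2, 3} \<and> partition_on S (A ` {1, 2, 3})"

end

theory Submission
  imports Defs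
begin

text \<open>
  Call a subset of \<open>Y \<times> Z\<close> big if countably many lines do not cover it. The partitions come from
  a Bernstein-style transfinite construction over a family of at most \<open>2\<^sup>\<aleph>\<^sup>0\<close> closed sets, each of
  which contains \<open>2\<^sup>\<aleph>\<^sup>0\<close> points no two of which share a coordinate. Since \<open>Y \<times> Z\<close> may have more
  than \<open>2\<^sup>\<aleph>\<^sup>0\<close> closed subsets, the family cannot consist of all big closed sets. It consists of
  the whole space and of closures of countable sets, and the point is that every big closed set
  contains the closure of a countable set that has so many points.

  Let \<open>F\<close> be closed and big. By \<open>\<sigma>\<close>-compactness \<open>F\<close> has a big compact subset \<open>K\<close>. Consider the
  points of \<open>K\<close> all of whose neighbourhoods meet \<open>K\<close> in a big set. If no two of them differed in
  both coordinates, they would all lie on one line. This line is a \<open>G\<^sub>\<delta>\<close> set, because points are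
  \<open>G\<^sub>\<delta>\<close> in first-countable Hausdorff spaces; so the rest of \<open>K\<close> would be a countable union of
  compact sets without such points, hence not big, and \<open>K\<close> would not be big either. Disjoint closed
  neighbourhoods of the coordinates of two such points cut out of \<open>K\<close> two big compact pieces with
  disjoint projections to both factors (\<open>split_compact\<close>).

  Iterating gives a binary tree of big compact sets. One point from each node makes a countable set
  whose closure, by compactness, meets the intersection along every branch, and points from
  different branches differ in both coordinates (\<open>countable_subset_with_spread_closure\<close>).

  Countable subsets of \<open>Y \<times> Z\<close> are coded by sets of natural numbers. A recursion of length
  \<open>2\<^sup>\<aleph>\<^sup>0\<close> over the triples consisting of a code and two labels chooses a point in each coded closed
  set so that no coordinate is used twice (\<open>injective_choice\<close>). The coordinates of the point chosen
  for \<open>(X, i, j)\<close> can therefore be labelled \<open>i\<close> and \<open>j\<close> without conflict, and the labels give the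
  partitions.
\<close>

section \<open>Sets covered by countably many lines\<close>

text \<open>\<open>S\<close> is contained in a union of countably many lines of \<open>Y \<times> Z\<close>.\<close>

definition line_coverable :: "'a topology \<Rightarrow> 'b topology \<Rightarrow> ('a \<times> 'b) set \<Rightarrow> bool" where
  "line_coverable Y Z S \<longleftrightarrow> (\<exists>\<L>. countable \<L> \<and> \<L> \<subseteq> lines Y Z \<and> S \<subseteq> \<Union>\<L>)"

lemma line_coverable_subset:
  "line_coverable Y Z T \<Longrightarrow> S \<subseteq> T \<Longrightarrow> line_coverable Y Z S"
  unfolding line_coverable_def by (meson subset_trans)

lemma line_coverable_empty: "line_coverable Y Z {}"
  unfolding line_coverable_def by (rule exI[of _ "{}"]) auto

lemma line_coverable_Union:
  assumes "countable \<S>" and "\<And>S. S \<in> \<S> \<Longrightarrow> line_coverable Y Z S"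
  shows "line_coverable Y Z (\<Union>\<S>)"
proof -
  obtain \<L> where \<L>: "\<And>S. S \<in> \<S> \<Longrightarrow> countable (\<L> S) \<and> \<L> S \<subseteq> lines Y Z \<and> S \<subseteq> \<Union>(\<L> S)"
    using assms(2) unfolding line_coverable_def by metis
  have "countable (\<Union>S\<in>\<S>. \<L> S)"
    using assms(1) \<L> by blast
  moreover have "(\<Union>S\<in>\<S>. \<L> S) \<subseteq> lines Y Z" and "\<Union>\<S> \<subseteq> \<Union>(\<Union>S\<in>\<S>. \<L> S)"
  proof -
    show "(\<Union>S\<in>\<S>. \<L> S) \<subseteq> lines Y Z"
      using \<L> by (intro UN_least) simp
    show "\<Union>\<S> \<subseteq> \<Union>(\<Union>S\<in>\<S>. \<L> S)"
    proof
      fix p assume "p \<in> \<Union>\<S>"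
      then obtain S where "S \<in> \<S>" "p \<in> S"
        by blast
      moreover from this obtain L where "L \<in> \<L> S" "p \<in> L"
        using \<L>[of S] by blast
      ultimately show "p \<in> \<Union>(\<Union>S\<in>\<S>. \<L> S)"
        by blast
    qed
  qed
  ultimately show ?thesis
    unfolding line_coverable_def by (intro exI[of _ "\<Union>S\<in>\<S>. \<L> S"] conjI)
qed

lemma line_coverable_Un:
  "line_coverable Y Z S \<Longrightarrow> line_coverable Y Z T \<Longrightarrow> line_coverable Y Z (S \<union> T)"
  using line_coverable_Union[of "{S, T}" Y Z] by auto

lemma line_coverable_line: "L \<in> lines Y Z \<Longrightarrow> line_coverable Y Z L"
  unfolding line_coverable_def by (rule exI[of _ "{L}"]) auto

section \<open>Splitting compact sets that countably many lines do not cover\<close>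

text \<open>A point of \<open>K\<close> at which \<open>K\<close> is locally not covered by countably many lines.\<close>

definition condensation_point ::
    "'a topology \<Rightarrow> 'b topology \<Rightarrow> ('a \<times> 'b) set \<Rightarrow> 'a \<times> 'b \<Rightarrow> bool" where
  "condensation_point Y Z K p \<longleftrightarrow> p \<in> K \<and>
     (\<forall>W. openin (prod_topology Y Z) W \<and> p \<in> W \<longrightarrow> \<not> line_coverable Y Z (K \<inter> W))"

lemma line_coverable_if_no_condensation_point:
  assumes K: "compactin (prod_topology Y Z) K"
    and none: "\<And>p. \<not> condensation_point Y Z K p"
  shows "line_coverable Y Z K"
proof -
  let ?\<W> = "{W. openin (prod_topology Y Z) W \<and> line_coverable Y Z (K \<inter> W)}"
  have "K \<subseteq> \<Union>?\<W>"
    using none unfolding condensation_point_def by blast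
  then obtain \<F> where \<F>: "finite \<F>" "\<F> \<subseteq> ?\<W>" "K \<subseteq> \<Union>\<F>"
    using K unfolding compactin_def by (metis (no_types, lifting) mem_Collect_eq)
  have "line_coverable Y Z (\<Union>W\<in>\<F>. K \<inter> W)"
    using \<F> by (intro line_coverable_Union) (auto intro: countable_finite)
  then show ?thesis
    by (rule line_coverable_subset) (use \<F>(3) in blast)
qed

text \<open>If \<open>G = \<Inter>\<V>\<close> contains all condensation points of the compact set \<open>K\<close>, then each \<open>K - V\<close> with
  \<open>V \<in> \<V>\<close> is compact without condensation points, so only \<open>K \<inter> G\<close> matters.\<close>

lemma line_coverable_if_G_delta:
  assumes K: "compactin (prod_topology Y Z) K" and "countable \<V>"
    and op: "\<And>V. V \<in> \<V> \<Longrightarrow> openin (prod_topology Y Z) V"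
    and cond: "\<And>V p. V \<in> \<V> \<Longrightarrow> condensation_point Y Z K p \<Longrightarrow> p \<in> V"
    and G: "line_coverable Y Z (K \<inter> \<Inter>\<V>)"
  shows "line_coverable Y Z K"
proof -
  have "line_coverable Y Z (K - V)" if V: "V \<in> \<V>" for V
  proof (rule line_coverable_if_no_condensation_point)
    have "closedin (prod_topology Y Z) (topspace (prod_topology Y Z) - V)"
      using op[OF V] by blast
    then have "compactin (prod_topology Y Z) ((topspace (prod_topology Y Z) - V) \<inter> K)"
      using K by (rule closed_Int_compactin)
    moreover have "(topspace (prod_topology Y Z) - V) \<inter> K = K - V"
      using compactin_subset_topspace[OF K] by blast
    ultimately show "compactin (prod_topology Y Z) (K - V)"
      by simp
    show "\<not> condensation_point Y Z (K - V) p" for p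
    proof
      assume p: "condensation_point Y Z (K - V) p"
      then have "condensation_point Y Z K p"
        unfolding condensation_point_def by (meson Diff_subset DiffD1 Int_mono line_coverable_subset order_refl)
      then show False
        using cond V p unfolding condensation_point_def by blast
    qed
  qed
  then have "line_coverable Y Z (\<Union>V\<in>\<V>. K - V)"
    using \<open>countable \<V>\<close> by (intro line_coverable_Union) auto
  from line_coverable_Un[OF this G] show ?thesis
    by (rule line_coverable_subset) blast
qed

lemma singleton_G_delta:
  assumes "Hausdorff_space X" and "first_countable X" and x: "x \<in> topspace X"
  obtains \<V> where "countable \<V>" "\<forall>V\<in>\<V>. openin X V \<and> x \<in> V"
    "topspace X \<inter> \<Inter>\<V> = {x}"
proof -
  obtain \<B> where \<B>: "countable \<B>" "\<forall>V\<in>\<B>. openin X V"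
      "\<forall>U. openin X U \<and> x \<in> U \<longrightarrow> (\<exists>V\<in>\<B>. x \<in> V \<and> V \<subseteq> U)"
    using bspec[OF assms(2)[unfolded first_countable_def] x] by (elim exE conjE)
  let ?\<V> = "{V \<in> \<B>. x \<in> V}"
  have "y = x" if y: "y \<in> topspace X" "\<And>V. V \<in> ?\<V> \<Longrightarrow> y \<in> V" for y
  proof (rule ccontr)
    assume "y \<noteq> x"
    then obtain U U' where U: "openin X U" "x \<in> U" "y \<in> U'" "disjnt U U'"
      using assms(1) x y(1) unfolding Hausdorff_space_def by metis
    then obtain V where "V \<in> \<B>" "x \<in> V" "V \<subseteq> U"
      using \<B>(3) by blast
    then have "y \<in> U"
      using y(2)[of V] by blast
    with U show False
      by (simp add: disjnt_iff)
  qed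
  then have "topspace X \<inter> \<Inter>?\<V> \<subseteq> {x}"
    by simp blast
  moreover have "x \<in> topspace X \<inter> \<Inter>?\<V>"
    using x by simp
  ultimately have "topspace X \<inter> \<Inter>?\<V> = {x}"
    by (intro equalityI) simp_all
  moreover have "countable ?\<V>"
    by (rule countable_subset[OF _ \<B>(1)]) simp
  moreover have "\<forall>V\<in>?\<V>. openin X V \<and> x \<in> V"
    using \<B>(2) by simp
  ultimately show ?thesis
    by (intro that[of ?\<V>])
qed

lemma exists_condensation_points_in_general_position:
  assumes Y: "Hausdorff_space Y" "first_countable Y" and Z: "Hausdorff_space Z" "first_countable Z"
    and K: "compactin (prod_topology Y Z) K" and big: "\<not> line_coverable Y Z K"
  obtains p q where "condensation_point Y Z K p" "condensation_point Y Z K q"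
    "fst p \<noteq> fst q" "snd p \<noteq> snd q"
proof (rule ccontr)
  assume contra: "\<not> thesis"
  note goal = that
  have share: "fst p = fst q \<or> snd p = snd q"
    if "condensation_point Y Z K p" "condensation_point Y Z K q" for p q
    using contra goal[OF that] by blast
  have K_sub: "K \<subseteq> topspace Y \<times> topspace Z"
    using compactin_subset_topspace[OF K] by simp
  have no_fst: "\<exists>p. condensation_point Y Z K p \<and> fst p \<noteq> y" if y: "y \<in> topspace Y" for y
  proof (rule ccontr)
    assume all: "\<nexists>p. condensation_point Y Z K p \<and> fst p \<noteq> y"
    obtain \<V> where \<V>: "countable \<V>" "\<forall>V\<in>\<V>. openin Y V \<and> y \<in> V"
        "topspace Y \<inter> \<Inter>\<V> = {y}"
      using singleton_G_delta[OF Y y] .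
    have "line_coverable Y Z K"
    proof (rule line_coverable_if_G_delta[OF K, of "(\<lambda>V. V \<times> topspace Z) ` \<V>"])
      show "openin (prod_topology Y Z) W" if "W \<in> (\<lambda>V. V \<times> topspace Z) ` \<V>" for W
        using that \<V>(2) by (auto simp: openin_prod_Times_iff)
      show "p \<in> W" if "W \<in> (\<lambda>V. V \<times> topspace Z) ` \<V>" "condensation_point Y Z K p" for W p
      proof -
        have "fst p = y"
          using that(2) all by blast
        moreover have "snd p \<in> topspace Z"
          using that(2) K_sub unfolding condensation_point_def by auto
        ultimately show ?thesis
          using that(1) \<V>(2) by (auto simp: mem_Times_iff)
      qed
      have "line_coverable Y Z ({y} \<times> topspace Z)"
        using y by (intro line_coverable_line) (auto simp: lines_def)
      moreover have "K \<inter> \<Inter>((\<lambda>V. V \<times> topspace Z) ` \<V>) \<subseteq> {y} \<times> topspace Z"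
      proof clarify
        fix a b assume ab: "(a, b) \<in> K" "(a, b) \<in> \<Inter>((\<lambda>V. V \<times> topspace Z) ` \<V>)"
        then have "a \<in> topspace Y \<inter> \<Inter>\<V>" "b \<in> topspace Z"
          using K_sub by auto
        then show "a \<in> {y} \<and> b \<in> topspace Z"
          using \<V>(3) by simp
      qed
      ultimately show "line_coverable Y Z (K \<inter> \<Inter>((\<lambda>V. V \<times> topspace Z) ` \<V>))"
        by (rule line_coverable_subset)
    qed (use \<V>(1) in simp)
    with big show False ..
  qed
  have no_snd: "\<exists>p. condensation_point Y Z K p \<and> snd p \<noteq> z" if z: "z \<in> topspace Z" for z
  proof (rule ccontr)
    assume all: "\<nexists>p. condensation_point Y Z K p \<and> snd p \<noteq> z"
    obtain \<V> where \<V>: "countable \<V>" "\<forall>V\<in>\<V>. openin Z V \<and> z \<in> V"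
        "topspace Z \<inter> \<Inter>\<V> = {z}"
      using singleton_G_delta[OF Z z] .
    have "line_coverable Y Z K"
    proof (rule line_coverable_if_G_delta[OF K, of "(\<lambda>V. topspace Y \<times> V) ` \<V>"])
      show "openin (prod_topology Y Z) W" if "W \<in> (\<lambda>V. topspace Y \<times> V) ` \<V>" for W
        using that \<V>(2) by (auto simp: openin_prod_Times_iff)
      show "p \<in> W" if "W \<in> (\<lambda>V. topspace Y \<times> V) ` \<V>" "condensation_point Y Z K p" for W p
      proof -
        have "snd p = z"
          using that(2) all by blast
        moreover have "fst p \<in> topspace Y"
          using that(2) K_sub unfolding condensation_point_def by auto
        ultimately show ?thesis
          using that(1) \<V>(2) by (auto simp: mem_Times_iff)
      qed
      have "line_coverable Y Z (topspace Y \<times> {z})"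
        using z by (intro line_coverable_line) (auto simp: lines_def)
      moreover have "K \<inter> \<Inter>((\<lambda>V. topspace Y \<times> V) ` \<V>) \<subseteq> topspace Y \<times> {z}"
      proof clarify
        fix a b assume ab: "(a, b) \<in> K" "(a, b) \<in> \<Inter>((\<lambda>V. topspace Y \<times> V) ` \<V>)"
        then have "a \<in> topspace Y" "b \<in> topspace Z \<inter> \<Inter>\<V>"
          using K_sub by auto
        then show "a \<in> topspace Y \<and> b \<in> {z}"
          using \<V>(3) by simp
      qed
      ultimately show "line_coverable Y Z (K \<inter> \<Inter>((\<lambda>V. topspace Y \<times> V) ` \<V>))"
        by (rule line_coverable_subset)
    qed (use \<V>(1) in simp)
    with big show False ..
  qed
  \<comment> \<open>A point \<open>q\<close> off the vertical line and a point \<open>r\<close> off the horizontal line through \<open>p\<close> each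
    share the other coordinate with \<open>p\<close>, so they share no coordinate with each other.\<close>
  obtain p where p: "condensation_point Y Z K p"
    using line_coverable_if_no_condensation_point[OF K] big by blast
  then have "fst p \<in> topspace Y" "snd p \<in> topspace Z"
    using K_sub unfolding condensation_point_def by auto
  then obtain q r where q: "condensation_point Y Z K q" "fst q \<noteq> fst p"
      and r: "condensation_point Y Z K r" "snd r \<noteq> snd p"
    using no_fst no_snd by meson
  then show False
    using share[OF p q(1)] share[OF p r(1)] share[OF q(1) r(1)] by auto
qed

lemma disjoint_closed_neighbourhoods:
  assumes "Hausdorff_space X" and "locally_compact_space X"
    and "x \<in> topspace X" "y \<in> topspace X" "x \<noteq> y"
  obtains U C V D where "openin X U" "x \<in> U" "U \<subseteq> C" "closedin X C"
    "openin X V" "y \<in> V" "V \<subseteq> D" "closedin X D" "C \<inter> D = {}"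
proof -
  obtain M N where MN: "openin X M" "openin X N" "x \<in> M" "y \<in> N" "disjnt M N"
    using assms unfolding Hausdorff_space_def by metis
  have "neighbourhood_base_of (closedin X) X"
    using assms by (simp add: neighbourhood_base_of_closedin locally_compact_Hausdorff_imp_regular_space)
  then have nb: "\<exists>U C. openin X U \<and> closedin X C \<and> w \<in> U \<and> U \<subseteq> C \<and> C \<subseteq> W"
    if "openin X W" "w \<in> W" for W w
    using that unfolding neighbourhood_base_of by blast
  obtain U C where UC: "openin X U" "closedin X C" "x \<in> U" "U \<subseteq> C" "C \<subseteq> M"
    using nb[OF MN(1,3)] by blast
  obtain V D where VD: "openin X V" "closedin X D" "y \<in> V" "V \<subseteq> D" "D \<subseteq> N"
    using nb[OF MN(2,4)] by blast
  have "C \<inter> D = {}"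
    using UC(5) VD(5) MN(5) unfolding disjnt_def by blast
  then show thesis
    using that UC VD by blast
qed

lemma split_compact:
  assumes Y: "Hausdorff_space Y" "locally_compact_space Y" "first_countable Y"
    and Z: "Hausdorff_space Z" "locally_compact_space Z" "first_countable Z"
    and K: "compactin (prod_topology Y Z) K" and big: "\<not> line_coverable Y Z K"
  shows "\<exists>s. (\<forall>b::bool. compactin (prod_topology Y Z) (s b) \<and> \<not> line_coverable Y Z (s b) \<and> s b \<subseteq> K) \<and>
    fst ` s False \<inter> fst ` s True = {} \<and> snd ` s False \<inter> snd ` s True = {}"
proof -
  obtain p q where p: "condensation_point Y Z K p" and q: "condensation_point Y Z K q"
    and ne: "fst p \<noteq> fst q" "snd p \<noteq> snd q"
    using exists_condensation_points_in_general_position[OF Y(1,3) Z(1,3) K big] .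
  have top: "fst p \<in> topspace Y" "fst q \<in> topspace Y" "snd p \<in> topspace Z" "snd q \<in> topspace Z"
  proof -
    have "p \<in> K" "q \<in> K"
      using p q unfolding condensation_point_def by blast+
    then have "p \<in> topspace (prod_topology Y Z)" "q \<in> topspace (prod_topology Y Z)"
      using compactin_subset_topspace[OF K] by blast+
    then show "fst p \<in> topspace Y" "fst q \<in> topspace Y" "snd p \<in> topspace Z" "snd q \<in> topspace Z"
      by (simp_all add: mem_Times_iff)
  qed
  obtain U C V D where Y': "openin Y U" "fst p \<in> U" "U \<subseteq> C" "closedin Y C"
    "openin Y V" "fst q \<in> V" "V \<subseteq> D" "closedin Y D" "C \<inter> D = {}"
    using disjoint_closed_neighbourhoods[OF Y(1,2) top(1,2) ne(1)] .
  obtain U' C' V' D' where Z': "openin Z U'" "snd p \<in> U'" "U' \<subseteq> C'" "closedin Z C'"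
    "openin Z V'" "snd q \<in> V'" "V' \<subseteq> D'" "closedin Z D'" "C' \<inter> D' = {}"
    using disjoint_closed_neighbourhoods[OF Z(1,2) top(3,4) ne(2)] .
  have piece: "compactin (prod_topology Y Z) ((E \<times> E') \<inter> K) \<and> \<not> line_coverable Y Z ((E \<times> E') \<inter> K)"
    if r: "condensation_point Y Z K r" and W: "openin Y W" "fst r \<in> W" "W \<subseteq> E" "closedin Y E"
      and W': "openin Z W'" "snd r \<in> W'" "W' \<subseteq> E'" "closedin Z E'" for r W E W' E'
  proof
    show "compactin (prod_topology Y Z) ((E \<times> E') \<inter> K)"
      using W(4) W'(4) K by (intro closed_Int_compactin) (simp_all add: closedin_prod_Times_iff)
    have "openin (prod_topology Y Z) (W \<times> W')" "r \<in> W \<times> W'"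
      using W W' by (auto simp: openin_prod_Times_iff mem_Times_iff)
    then have "\<not> line_coverable Y Z (K \<inter> (W \<times> W'))"
      using r unfolding condensation_point_def by blast
    moreover have "K \<inter> (W \<times> W') \<subseteq> (E \<times> E') \<inter> K"
      using W(3) W'(3) by blast
    ultimately show "\<not> line_coverable Y Z ((E \<times> E') \<inter> K)"
      using line_coverable_subset by blast
  qed
  define s where "s = (\<lambda>b. (if b then C \<times> C' else D \<times> D') \<inter> K)"
  have "compactin (prod_topology Y Z) (s b) \<and> \<not> line_coverable Y Z (s b) \<and> s b \<subseteq> K" for b
    using piece[OF p Y'(1-4) Z'(1-4)] piece[OF q Y'(5-8) Z'(5-8)] by (simp add: s_def)
  moreover have "fst ` s False \<inter> fst ` s True = {} \<and> snd ` s False \<inter> snd ` s True = {}"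
  proof -
    have "fst ` s False \<subseteq> D" "fst ` s True \<subseteq> C" "snd ` s False \<subseteq> D'" "snd ` s True \<subseteq> C'"
      by (auto simp: s_def)
    then show ?thesis
      using Y'(9) Z'(9) by blast
  qed
  ultimately show ?thesis
    by (intro exI[of _ s]) simp
qed

section \<open>Countable sets with spread closure\<close>

text \<open>A set is spread if it contains continuum many points that pairwise differ in both coordinates;
  \<^typ>\<open>nat set\<close> serves as an index set of cardinality \<open>2\<^sup>\<aleph>\<^sup>0\<close>.\<close>

definition spread :: "('a \<times> 'b) set \<Rightarrow> bool" where
  "spread S \<longleftrightarrow> (\<exists>p :: nat set \<Rightarrow> 'a \<times> 'b. inj (fst \<circ> p) \<and> inj (snd \<circ> p) \<and> range p \<subseteq> S)"

text \<open>The node at level \<open>n\<close> of the binary tree on the branch given by the characteristic function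
  of \<open>x\<close>. The most recent choice comes first, so that passing to a child is a \<^const>\<open>Cons\<close>.\<close>

primrec branch :: "nat set \<Rightarrow> nat \<Rightarrow> bool list" where
  "branch x 0 = []"
| "branch x (Suc n) = (n \<in> x) # branch x n"

lemma branch_cong: "(\<And>k. k < n \<Longrightarrow> k \<in> x \<longleftrightarrow> k \<in> y) \<Longrightarrow> branch x n = branch y n"
  by (induction n) auto

lemma branch_split:
  assumes "x \<noteq> y"
  obtains n where "branch x n = branch y n" "(n \<in> x) \<noteq> (n \<in> y)"
proof -
  have ex: "\<exists>n. (n \<in> x) \<noteq> (n \<in> y)"
    using assms by blast
  let ?n = "LEAST n. (n \<in> x) \<noteq> (n \<in> y)"
  have "branch x ?n = branch y ?n"
    by (rule branch_cong) (use not_less_Least in blast)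
  then show thesis
    using that LeastI_ex[OF ex] by blast
qed

lemma countable_subset_with_spread_closure:
  assumes Y: "Hausdorff_space Y" "locally_compact_space Y" "first_countable Y"
    and Z: "Hausdorff_space Z" "locally_compact_space Z" "first_countable Z"
    and K: "compactin (prod_topology Y Z) K" and big: "\<not> line_coverable Y Z K"
  obtains d :: "nat \<Rightarrow> 'a \<times> 'b"
    where "range d \<subseteq> K" "spread (prod_topology Y Z closure_of range d)"
proof -
  let ?P = "prod_topology Y Z"
  have Haus: "Hausdorff_space ?P"
    using Y(1) Z(1) by (simp add: Hausdorff_space_prod_topology)
  define good where "good = (\<lambda>K. compactin ?P K \<and> \<not> line_coverable Y Z K)"
  have "\<forall>K. \<exists>s. good K \<longrightarrow> (\<forall>b::bool. good (s b) \<and> s b \<subseteq> K) \<and>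
      fst ` s False \<inter> fst ` s True = {} \<and> snd ` s False \<inter> snd ` s True = {}"
    using split_compact[OF Y Z] unfolding good_def by metis
  then obtain s where s: "\<And>K b. good K \<Longrightarrow> good (s K b) \<and> s K b \<subseteq> K"
      and s_disj: "\<And>K. good K \<Longrightarrow> fst ` s K False \<inter> fst ` s K True = {} \<and>
        snd ` s K False \<inter> snd ` s K True = {}"
    by metis
  \<comment> \<open>The tree of pieces: the children of the node \<open>l\<close> carry the two sets split off from \<open>T l\<close>.\<close>
  define T where "T = rec_list K (\<lambda>b _ t. s t b)"
  have T_Nil: "T [] = K" and T_Cons: "\<And>b l. T (b # l) = s (T l) b"
    by (simp_all add: T_def)
  have good_T: "good (T l)" for l
    by (induction l) (use K big s in \<open>auto simp: T_Nil T_Cons good_def\<close>)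
  have T_Cons_subset: "T (b # l) \<subseteq> T l" for b l
    using s[OF good_T] by (simp add: T_Cons)
  have T_mono: "T (branch x n) \<subseteq> T (branch x m)" if "m \<le> n" for x m n
    using that by (induction n rule: dec_induct) (use T_Cons_subset in fastforce)+
  have T_sub: "T l \<subseteq> K" for l
    by (induction l) (use T_Cons_subset T_Nil in fastforce)+
  have closed_T: "closedin ?P (T l)" for l
    using good_T compactin_imp_closedin[OF Haus] unfolding good_def by blast
  have "\<exists>p. p \<in> T l" for l
    using good_T[of l] line_coverable_empty[of Y Z] unfolding good_def by (metis ex_in_conv)
  then obtain e where e: "\<And>l. e l \<in> T l"
    by metis
  have "\<exists>p. p \<in> ?P closure_of range e \<and> (\<forall>n. p \<in> T (branch x n))" for x
  proof -
    \<comment> \<open>A cluster point of the chosen points along the branch lies in all pieces on the branch.\<close>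
    define G where "G = (\<lambda>n. ?P closure_of (\<lambda>m. e (branch x m)) ` {n..})"
    have top: "e l \<in> topspace ?P" for l
      using e T_sub compactin_subset_topspace[OF K] by blast
    have G_T: "G n \<subseteq> T (branch x n)" for n
      unfolding G_def using e T_mono by (intro closure_of_minimal closed_T) force
    have G_ne: "e (branch x n) \<in> G n" for n
    proof -
      have "(\<lambda>m. e (branch x m)) ` {n..} \<subseteq> G n"
        unfolding G_def by (intro closure_of_subset image_subsetI top)
      then show ?thesis by auto
    qed
    have G_mono: "G n \<subseteq> G m" if "m \<le> n" for m n
      unfolding G_def using that by (intro closure_of_mono image_mono) auto
    have "K \<inter> \<Inter>(range G) \<noteq> {}"
    proof (rule compactin_fip[THEN iffD1, OF K, THEN conjunct2, rule_format])
      show "(\<forall>C\<in>range G. closedin ?P C) \<and> (\<forall>\<F>. finite \<F> \<and> \<F> \<subseteq> range G \<longrightarrow> K \<inter> \<Inter>\<F> \<noteq> {})"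
      proof (intro conjI ballI allI impI)
        show "closedin ?P C" if "C \<in> range G" for C
          using that unfolding G_def by auto
        fix \<F> assume "finite \<F> \<and> \<F> \<subseteq> range G"
        then obtain I where I: "finite I" "\<F> = G ` I"
          by (meson finite_subset_image)
        then obtain N where "I \<subseteq> {..N}"
          by (auto simp: finite_nat_iff_bounded_le)
        then have "e (branch x N) \<in> \<Inter>\<F>"
          using G_ne[of N] G_mono I(2) by blast
        moreover have "e (branch x N) \<in> K"
          using e T_sub by blast
        ultimately show "K \<inter> \<Inter>\<F> \<noteq> {}"
          by blast
      qed
    qed
    then obtain p where p: "\<And>n. p \<in> G n"
      by blast
    have "G 0 \<subseteq> ?P closure_of range e"
      unfolding G_def by (intro closure_of_mono) auto
    then show ?thesis
      using p G_T by blast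
  qed
  then obtain p where p_cl: "\<And>x. p x \<in> ?P closure_of range e"
      and p_T: "\<And>x n. p x \<in> T (branch x n)"
    by metis
  have diff: "fst (p x) \<noteq> fst (p y) \<and> snd (p x) \<noteq> snd (p y)" if xy: "x \<noteq> y" for x y
  proof -
    obtain n where n: "branch x n = branch y n" "(n \<in> x) \<noteq> (n \<in> y)"
      using branch_split[OF xy] .
    have mem: "p x \<in> s (T (branch x n)) (n \<in> x)" "p y \<in> s (T (branch x n)) (n \<in> y)"
      using p_T[of x "Suc n"] p_T[of y "Suc n"] n(1) by (simp_all add: T_Cons)
    show ?thesis
      using s_disj[OF good_T, of "branch x n"] mem n(2) by (cases "n \<in> x"; cases "n \<in> y") force+
  qed
  have "spread (?P closure_of range e)"
    unfolding spread_def
  proof (intro exI conjI)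
    show "inj (fst \<circ> p)" "inj (snd \<circ> p)"
      using diff by (auto simp: inj_def)
    show "range p \<subseteq> ?P closure_of range e"
      using p_cl by blast
  qed
  moreover have "range (e \<circ> from_nat) = range e"
    by (metis image_comp surj_from_nat)
  ultimately show thesis
    using that[of "e \<circ> from_nat"] e T_sub by (metis image_subset_iff range_subsetD subset_iff)
qed

section \<open>Transfinite choice\<close>

text \<open>Recursion along a well-order of minimal length: at each stage fewer than \<open>|'i|\<close> points have
  been chosen, and each of them excludes at most two of the \<open>|'i|\<close> candidates, one per coordinate.\<close>

lemma injective_choice:
  includes cardinal_syntax
  fixes P :: "'i \<Rightarrow> ('a \<times> 'b) set"
  assumes inf: "infinite (UNIV :: 'i set)"
    and P: "\<And>i. \<exists>p :: 'i \<Rightarrow> 'a \<times> 'b. inj (fst \<circ> p) \<and> inj (snd \<circ> p) \<and> range p \<subseteq> P i"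
  shows "\<exists>f. inj (fst \<circ> f) \<and> inj (snd \<circ> f) \<and> (\<forall>i. f i \<in> P i)"
proof -
  let ?r = "|UNIV :: 'i set|"
  let ?R = "?r - Id"
  have wo: "well_order_on UNIV ?r"
    by (rule card_of_well_order_on)
  let ?Q = "\<lambda>f i q. q \<in> P i \<and> (\<forall>k. (k, i) \<in> ?R \<longrightarrow> fst q \<noteq> fst (f k) \<and> snd q \<noteq> snd (f k))"
  have "\<exists>f. \<forall>i. ?Q f i (f i)"
  proof (rule dependent_wf_choice)
    show "wf ?R"
      using wo unfolding well_order_on_def by blast
    show "?Q f i q = ?Q g i q" if "\<And>k. (k, i) \<in> ?R \<Longrightarrow> f k = g k" for f g i q
      using that by auto
    fix i and f :: "'i \<Rightarrow> 'a \<times> 'b"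
    obtain p :: "'i \<Rightarrow> 'a \<times> 'b" where p: "inj (fst \<circ> p)" "inj (snd \<circ> p)" "range p \<subseteq> P i"
      using P by blast
    let ?S = "underS ?r i"
    have S: "|?S| <o ?r"
      by (rule card_of_underS[OF card_of_Card_order]) (simp only: Field_card_of UNIV_I)
    have "|{x. (h \<circ> p) x \<in> (h \<circ> f) ` ?S}| <o ?r" if "inj (h \<circ> p)" for h :: "'a \<times> 'b \<Rightarrow> 'c"
    proof -
      have "|{x. (h \<circ> p) x \<in> (h \<circ> f) ` ?S}| \<le>o |(h \<circ> f) ` ?S|"
        using inj_on_subset[OF that subset_UNIV] by (intro card_of_ordLeq[THEN iffD1] exI[of _ "h \<circ> p"]) auto
      then show ?thesis
        using card_of_image S by (meson ordLeq_ordLess_trans)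
    qed
    note small = this
    have "|{x. (fst \<circ> p) x \<in> (fst \<circ> f) ` ?S} \<union> {x. (snd \<circ> p) x \<in> (snd \<circ> f) ` ?S}| <o ?r"
      by (intro card_of_Un_ordLess_infinite inf) (use p in \<open>blast intro: small\<close>)+
    then have "{x. (fst \<circ> p) x \<in> (fst \<circ> f) ` ?S} \<union> {x. (snd \<circ> p) x \<in> (snd \<circ> f) ` ?S} \<noteq> UNIV"
      by (metis ordLess_irreflexive)
    then obtain x where "(fst \<circ> p) x \<notin> (fst \<circ> f) ` ?S" "(snd \<circ> p) x \<notin> (snd \<circ> f) ` ?S"
      by blast
    then have "?Q f i (p x)"
      using p(3) by (auto simp: underS_def)
    then show "\<exists>q. ?Q f i q" ..
  qed
  then obtain f where f: "\<And>i. ?Q f i (f i)"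
    by blast
  have total: "(i, k) \<in> ?R \<or> (k, i) \<in> ?R" if "i \<noteq> k" for i k
    using wo that unfolding well_order_on_def linear_order_on_def total_on_def by auto
  have "inj (fst \<circ> f)" "inj (snd \<circ> f)"
    unfolding inj_def comp_def using f total by metis+
  then show ?thesis
    using f by blast
qed

text \<open>A point is chosen for every triple of a code and two labels. The chosen points have distinct
  coordinates, so each coordinate determines the triple that it was chosen for.\<close>

lemma labels_meeting_spread_sets:
  fixes P :: "nat set \<Rightarrow> ('a \<times> 'b) set"
  assumes P: "\<And>X. spread (P X)"
  obtains a :: "'a \<Rightarrow> nat" and b :: "'b \<Rightarrow> nat"
    where "\<And>X i j. \<exists>q\<in>P X. a (fst q) = i \<and> b (snd q) = j"
proof -
  let ?I = "UNIV :: (nat set \<times> nat \<times> nat) set"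
  have "\<exists>g :: nat set \<times> nat \<times> nat \<Rightarrow> nat set. inj g"
  proof
    let ?g = "\<lambda>(X, i, j). (\<lambda>m. prod_encode (0, m)) ` X \<union> {prod_encode (1, i), prod_encode (2, j)}"
    show "inj ?g"
    proof (rule injI)
      fix t t' :: "nat set \<times> nat \<times> nat"
      assume "?g t = ?g t'"
      moreover obtain X i j X' i' j' where t: "t = (X, i, j)" "t' = (X', i', j')"
        by (metis prod.exhaust)
      ultimately have eq: "?g (X, i, j) = ?g (X', i', j')"
        by simp
      have "X = {m. prod_encode (0, m) \<in> ?g (X, i, j)}" "X' = {m. prod_encode (0, m) \<in> ?g (X', i', j')}"
        by (auto simp: prod_encode_eq)
      moreover have "{i} = {m. prod_encode (1, m) \<in> ?g (X, i, j)}" "{i'} = {m. prod_encode (1, m) \<in> ?g (X', i', j')}"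
        by (auto simp: prod_encode_eq)
      moreover have "{j} = {m. prod_encode (2, m) \<in> ?g (X, i, j)}" "{j'} = {m. prod_encode (2, m) \<in> ?g (X', i', j')}"
        by (auto simp: prod_encode_eq)
      ultimately have "X = X' \<and> i = i' \<and> j = j'"
        using eq by (metis singleton_inject)
      then show "t = t'"
        by (simp add: t)
    qed
  qed
  then obtain g :: "nat set \<times> nat \<times> nat \<Rightarrow> nat set" where g: "inj g" ..
  have "\<exists>f. inj (fst \<circ> f) \<and> inj (snd \<circ> f) \<and> (\<forall>t :: nat set \<times> nat \<times> nat. f t \<in> P (fst t))"
  proof (rule injective_choice)
    show "infinite ?I"
      by (simp add: finite_prod)
    fix t :: "nat set \<times> nat \<times> nat"
    obtain p :: "nat set \<Rightarrow> 'a \<times> 'b"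
      where "inj (fst \<circ> p)" "inj (snd \<circ> p)" "range p \<subseteq> P (fst t)"
      using P unfolding spread_def by blast
    then have "inj (fst \<circ> (p \<circ> g))" "inj (snd \<circ> (p \<circ> g))" "range (p \<circ> g) \<subseteq> P (fst t)"
      using g by (auto simp: inj_compose simp flip: comp_assoc)
    then show "\<exists>p :: nat set \<times> nat \<times> nat \<Rightarrow> 'a \<times> 'b.
        inj (fst \<circ> p) \<and> inj (snd \<circ> p) \<and> range p \<subseteq> P (fst t)"
      by blast
  qed
  then obtain f where f: "inj (fst \<circ> f)" "inj (snd \<circ> f)"
      "\<And>t :: nat set \<times> nat \<times> nat. f t \<in> P (fst t)"
    by blast
  show thesis
  proof (rule that)
    fix X i j
    show "\<exists>q\<in>P X. (\<lambda>y. fst (snd (inv (fst \<circ> f) y))) (fst q) = i \<and>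
        (\<lambda>z. snd (snd (inv (snd \<circ> f) z))) (snd q) = j"
      using f(3)[of "(X, i, j)"] inv_f_f[OF f(1), of "(X, i, j)"] inv_f_f[OF f(2), of "(X, i, j)"]
      by (intro bexI[of _ "f (X, i, j)"]) auto
  qed
qed

text \<open>There are at most \<open>2\<^sup>\<aleph>\<^sup>0\<close> sequences in a set of at most \<open>2\<^sup>\<aleph>\<^sup>0\<close> elements.\<close>

lemma code_sequences:
  assumes "S \<lesssim> (UNIV :: nat set set)"
  obtains c :: "nat set \<Rightarrow> nat \<Rightarrow> 'a"
    where "\<And>d. range d \<subseteq> S \<Longrightarrow> \<exists>X. c X = d"
proof -
  obtain h :: "'a \<Rightarrow> nat set" where h: "inj_on h S"
    using assms unfolding lepoll_def by blast
  show thesis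
  proof (rule that)
    fix d :: "nat \<Rightarrow> 'a" assume d: "range d \<subseteq> S"
    let ?X = "{k. snd (prod_decode k) \<in> h (d (fst (prod_decode k)))}"
    have "inv_into S h {m. prod_encode (n, m) \<in> ?X} = d n" for n
      using inv_into_f_f[OF h, of "d n"] d by auto
    then show "\<exists>X. (\<lambda>X n. inv_into S h {m. prod_encode (n, m) \<in> X}) X = d"
      by (intro exI[of _ ?X]) auto
  qed
qed

text \<open>Points whose label is none of 1, 2, 3 are put into the third part.\<close>

lemma partition_into_three_of_label:
  fixes a :: "'a \<Rightarrow> nat"
  assumes ne: "\<And>i. i \<in> {1, 2, 3} \<Longrightarrow> \<exists>x\<in>S. a x = i"
  shows "partition_into_three S (\<lambda>i. {x \<in> S. (if a x \<in> {1, 2} then a x else 3) = i})"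
proof -
  define A where "A = (\<lambda>i. {x \<in> S. (if a x \<in> {1, 2} then a x else 3) = i})"
  have A_ne: "A i \<noteq> {}" if "i \<in> {1, 2, 3}" for i
    using ne[OF that] that by (auto simp: A_def)
  have A_disj: "A i \<inter> A j = {}" if "i \<noteq> j" for i j
    using that by (auto simp: A_def)
  have "inj_on A {1, 2, 3}"
    using A_ne A_disj by (metis inf.idem inj_onI)
  moreover have "partition_on S (A ` {1, 2, 3})"
  proof (rule partition_onI)
    have "S \<subseteq> \<Union>(A ` {1, 2, 3})"
    proof
      fix x assume "x \<in> S"
      then have "x \<in> A (if a x \<in> {1, 2} then a x else 3)"
        by (simp add: A_def)
      moreover have "(if a x \<in> {1, 2} then a x else 3) \<in> {1, 2, 3}"
        by auto
      ultimately show "x \<in> \<Union>(A ` {1, 2, 3})"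
        by blast
    qed
    then show "\<Union>(A ` {1, 2, 3}) = S"
      unfolding A_def by blast
    show "disjnt p q" if pq: "p \<in> A ` {1, 2, 3}" "q \<in> A ` {1, 2, 3}" "p \<noteq> q" for p q
    proof -
      obtain i j where "p = A i" "q = A j"
        using pq(1,2) by (elim imageE)
      then show ?thesis
        using pq(3) A_disj[of i j] unfolding disjnt_def by metis
    qed
    show "{} \<notin> A ` {1, 2, 3}"
      using A_ne by (metis imageE)
  qed
  ultimately show ?thesis
    unfolding partition_into_three_def A_def by blast
qed

lemma compact_piece_not_line_coverable:
  assumes "sigma_compact_space Y" and "sigma_compact_space Z"
    and F: "closedin (prod_topology Y Z) F" and big: "\<not> line_coverable Y Z F"
  obtains K where "K \<subseteq> F" "compactin (prod_topology Y Z) K" "\<not> line_coverable Y Z K"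
proof -
  obtain \<K> \<M> where \<K>: "countable \<K>" "\<And>K. K \<in> \<K> \<Longrightarrow> compactin Y K" "\<Union>\<K> = topspace Y"
    and \<M>: "countable \<M>" "\<And>M. M \<in> \<M> \<Longrightarrow> compactin Z M" "\<Union>\<M> = topspace Z"
    using assms(1,2) unfolding sigma_compact_space_def by metis
  let ?\<S> = "(\<lambda>(K, M). F \<inter> (K \<times> M)) ` (\<K> \<times> \<M>)"
  have "F \<subseteq> \<Union>?\<S>"
  proof
    fix p assume p: "p \<in> F"
    then have "fst p \<in> \<Union>\<K>" "snd p \<in> \<Union>\<M>"
      using closedin_subset[OF F] \<K>(3) \<M>(3) by auto
    then show "p \<in> \<Union>?\<S>"
      using p by (force simp: mem_Times_iff)
  qed
  then have "\<not> line_coverable Y Z (\<Union>?\<S>)"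
    using big line_coverable_subset by blast
  then obtain K M where KM: "K \<in> \<K>" "M \<in> \<M>" "\<not> line_coverable Y Z (F \<inter> (K \<times> M))"
    using line_coverable_Union[of ?\<S> Y Z] \<K>(1) \<M>(1) by fastforce
  have "compactin (prod_topology Y Z) (F \<inter> (K \<times> M))"
    using F \<K>(2)[OF KM(1)] \<M>(2)[OF KM(2)]
    by (intro closed_Int_compactin) (simp_all add: compactin_Times)
  then show thesis
    using that KM(3) by blast
qed

section \<open>The partitions\<close>

theorem theorem8p2:
  fixes Y :: "'a topology" and Z :: "'b topology"
  assumes "Hausdorff_space Y" and "Hausdorff_space Z"
    and "locally_compact_space Y" and "locally_compact_space Z"
    and "sigma_compact_space Y" and "sigma_compact_space Z"
    and "first_countable Y" and "first_countable Z"
    and "topspace Y \<approx> (UNIV :: nat set set)" and "topspace Z \<approx> (UNIV :: nat set set)"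
  shows "\<exists>A B. partition_into_three (topspace Y) A \<and> partition_into_three (topspace Z) B \<and>
    (\<forall>F. closedin (prod_topology Y Z) F \<longrightarrow>
      (\<exists>\<L>. countable \<L> \<and> \<L> \<subseteq> lines Y Z \<and> F \<subseteq> \<Union>\<L>) \<or>
      (\<forall>i\<in>{1, 2, 3}. \<forall>j\<in>{1, 2, 3}. F \<inter> (A i \<times> B j) \<noteq> {}))"
proof -
  let ?P = "prod_topology Y Z"
  obtain u v where u: "bij_betw u (UNIV :: nat set set) (topspace Y)"
      and v: "bij_betw v (UNIV :: nat set set) (topspace Z)"
    using assms(9,10)[THEN eqpoll_sym] unfolding eqpoll_def by blast
  have spread_top: "spread (topspace ?P)"
    unfolding spread_def
  proof (intro exI[of _ "\<lambda>x. (u x, v x)"] conjI)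
    show "range (\<lambda>x. (u x, v x)) \<subseteq> topspace ?P"
      using u v by (auto simp: bij_betw_def)
  qed (use u v in \<open>auto simp: bij_betw_def inj_def\<close>)
  have "topspace ?P \<approx> (UNIV :: nat set set) \<times> (UNIV :: nat set set)"
    unfolding topspace_prod_topology by (intro times_eqpoll_cong assms)
  also have "\<dots> \<approx> (UNIV :: nat set set)"
    unfolding eqpoll_def card_of_ordIso
    by (rule card_of_Times_same_infinite) (simp add: Finite_Set.finite_set)
  finally have "topspace ?P \<lesssim> (UNIV :: nat set set)"
    by (rule eqpoll_imp_lepoll)
  then obtain c :: "nat set \<Rightarrow> nat \<Rightarrow> 'a \<times> 'b"
    where c: "\<And>d. range d \<subseteq> topspace ?P \<Longrightarrow> \<exists>X. c X = d"
    using code_sequences by metis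
  \<comment> \<open>Codes without a spread closure are assigned the whole space, so that every \<open>P X\<close> is spread.\<close>
  define P where "P = (\<lambda>X. let C = ?P closure_of range (c X) in if spread C then C else topspace ?P)"
  have P_sub: "P X \<subseteq> topspace ?P" for X
    unfolding P_def Let_def by (simp add: closure_of_subset_topspace del: topspace_prod_topology)
  have "spread (P X)" for X
    using spread_top by (simp add: P_def Let_def)
  then obtain a :: "'a \<Rightarrow> nat" and b :: "'b \<Rightarrow> nat"
    where ab: "\<And>X i j. \<exists>q\<in>P X. a (fst q) = i \<and> b (snd q) = j"
    using labels_meeting_spread_sets by metis
  define A where "A = (\<lambda>i. {y \<in> topspace Y. (if a y \<in> {1, 2} then a y else 3) = i})"
  define B where "B = (\<lambda>j. {z \<in> topspace Z. (if b z \<in> {1, 2} then b z else 3) = j})"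
  have hit: "\<exists>q\<in>P X. q \<in> A i \<times> B j" if "i \<in> {1, 2, 3}" "j \<in> {1, 2, 3}" for X i j
  proof -
    obtain q where q: "q \<in> P X" "a (fst q) = i" "b (snd q) = j"
      using ab by blast
    moreover have "fst q \<in> topspace Y" "snd q \<in> topspace Z"
      using q(1) P_sub[of X] by auto
    ultimately show ?thesis
      using that by (intro bexI[of _ q]) (auto simp: A_def B_def mem_Times_iff)
  qed
  have "\<exists>y\<in>topspace Y. a y = i" "\<exists>z\<in>topspace Z. b z = i" for i
    using ab[of undefined i i] P_sub by fastforce+
  then have parts: "partition_into_three (topspace Y) A" "partition_into_three (topspace Z) B"
    unfolding A_def B_def by (simp_all only: partition_into_three_of_label)
  have meets: "\<forall>i\<in>{1, 2, 3}. \<forall>j\<in>{1, 2, 3}. F \<inter> (A i \<times> B j) \<noteq> {}"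
    if F: "closedin ?P F" and big: "\<not> line_coverable Y Z F" for F
  proof -
    obtain K where K: "K \<subseteq> F" "compactin ?P K" "\<not> line_coverable Y Z K"
      using compact_piece_not_line_coverable[OF assms(5,6) F big] .
    obtain d :: "nat \<Rightarrow> 'a \<times> 'b"
      where d: "range d \<subseteq> K" "spread (?P closure_of range d)"
      using countable_subset_with_spread_closure[OF assms(1,3,7,2,4,8) K(2,3)] .
    obtain X where "c X = d"
      using c[of d] d(1) compactin_subset_topspace[OF K(2)] by blast
    then have "P X = ?P closure_of range d"
      using d(2) by (simp add: P_def Let_def)
    also have "\<dots> \<subseteq> F"
      using d(1) K(1) F by (intro closure_of_minimal) auto
    finally show ?thesis
      using hit[of _ _ X] by blast
  qed
  show ?thesis
  proof (intro exI conjI allI impI)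
    show "(\<exists>\<L>. countable \<L> \<and> \<L> \<subseteq> lines Y Z \<and> F \<subseteq> \<Union>\<L>) \<or>
        (\<forall>i\<in>{1, 2, 3}. \<forall>j\<in>{1, 2, 3}. F \<inter> (A i \<times> B j) \<noteq> {})" if "closedin ?P F" for F
      using meets[OF that] unfolding line_coverable_def by argo
  qed (fact parts)+
qed

end
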